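(* Let $Q$ be a nonzero commutative unital ring, let $n$ be a positive integer and let $\mathbf w=(w_1,\ldots,w_n)\in\mathbb Z_{\ge1}^n$, with $d_{\mathbf w}=\operatorname{lcm}(w_1,\ldots,w_n)$. If $$2d_{\mathbf w}>(\max(\mathbf w)-2)\sum_{i=1}^nw_i,$$ then $P_{\mathbf w}^{(d_{\mathbf w})}$ and $R_{\mathbf w}^{(d_{\mathbf w})}$ are generated in degree $1$.
   Context: $P_{\mathbf w}=Q[x_1,\ldots,x_n]$ is the polynomial ring graded by $\deg x_i=w_i$; $R_{\mathbf w}:=Q[\{t^dx_i\mid i\in\{1,\ldots,n\},\ d\in\{0,\ldots,w_i\}\}]$ is the Rees ring, a subring of $Q[t,x_1,\ldots,x_n]$ graded by the degree in $t$ (so $x_1,\ldots,x_n$ have degree $0$). For a $\mathbb Z_{\ge0}$-graded ring $S$ and an integer $r\ge1$, the $r$th Veronese subring is $S^{(r)}:=\bigoplus_{m\ge0}S_{rm}$, where $S_{rm}$ is the $m$th graded component of $S^{(r)}$. A graded ring $S$ is generated in degree $1$ if $S=S_0\oplus\bigoplus_{m\ge1}S_1^m$, where $S_1^m$ is the additive subgroup generated by $m$-fold products of elements of $S_1$. *)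

theory Defs
  imports Complex_Main "HOL-Library.Poly_Mapping" "HOL-Computational_Algebra.Group_Closure"
begin

section \<open>Internally graded commutative rings\<close>

definition is_subring :: "'b::comm_ring_1 set \<Rightarrow> bool" where
  "is_subring S \<longleftrightarrow> 1 \<in> S \<and> (\<forall>a\<in>S. \<forall>b\<in>S. a - b \<in> S \<and> a * b \<in> S)"

definition is_additive_subgroup :: "'b::ab_group_add set \<Rightarrow> bool" where
  "is_additive_subgroup A \<longleftrightarrow> 0 \<in> A \<and> (\<forall>a\<in>A. \<forall>b\<in>A. a - b \<in> A)"

definition finitely_supported :: "(nat \<Rightarrow> 'b::ab_group_add set) \<Rightarrow> (nat \<Rightarrow> 'b) set" where
  "finitely_supported A = {f. (\<forall>m. f m \<in> A m) \<and> finite {m. f m \<noteq> 0}}"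

definition total_sum :: "(nat \<Rightarrow> 'b::ab_group_add) \<Rightarrow> 'b" where
  "total_sum f = (\<Sum>m | f m \<noteq> 0. f m)"

text \<open>\<open>S\<close> is the internal direct sum of the additive subgroups \<open>A 0\<close>, \<open>A 1\<close>, \<open>\<dots>\<close>: the
  addition map from the external direct sum of the \<open>A m\<close> is a bijection onto \<open>S\<close>.\<close>
definition internal_direct_sum :: "'b::ab_group_add set \<Rightarrow> (nat \<Rightarrow> 'b set) \<Rightarrow> bool" where
  "internal_direct_sum S A \<longleftrightarrow>
     (\<forall>m. is_additive_subgroup (A m)) \<and> bij_betw total_sum (finitely_supported A) S"

text \<open>A graded ring is given by a subring \<open>S\<close> of the ambient type together with the family \<open>G\<close>
  of its graded components.\<close>
definition graded_ring :: "'b::comm_ring_1 set \<Rightarrow> (nat \<Rightarrow> 'b set) \<Rightarrow> bool" where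
  "graded_ring S G \<longleftrightarrow> is_subring S \<and> internal_direct_sum S G \<and>
     (\<forall>i j. \<forall>a\<in>G i. \<forall>b\<in>G j. a * b \<in> G (i + j))"

definition veronese_comp :: "nat \<Rightarrow> (nat \<Rightarrow> 'b set) \<Rightarrow> nat \<Rightarrow> 'b set" where
  "veronese_comp r G m = G (r * m)"

definition veronese_ring :: "nat \<Rightarrow> (nat \<Rightarrow> 'b::comm_ring_1 set) \<Rightarrow> 'b set" where
  "veronese_ring r G = total_sum ` finitely_supported (veronese_comp r G)"

text \<open>The additive subgroup generated by the \<open>m\<close>-fold products of elements of \<open>A\<close>.\<close>
definition set_pow :: "'b::comm_ring_1 set \<Rightarrow> nat \<Rightarrow> 'b set" where
  "set_pow A m = group_closure {\<Prod>i<m. f i | f. \<forall>i<m. f i \<in> A}"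

definition generated_in_degree_1 :: "'b::comm_ring_1 set \<Rightarrow> (nat \<Rightarrow> 'b set) \<Rightarrow> bool" where
  "generated_in_degree_1 S G \<longleftrightarrow> graded_ring S G \<and>
     internal_direct_sum S (\<lambda>m. if m = 0 then G 0 else set_pow (G 1) m)"


section \<open>The weighted polynomial ring and the Rees ring\<close>

text \<open>Both rings live in the polynomial ring over \<open>'a\<close> in variables indexed by \<open>nat\<close>:
  variable \<open>0\<close> plays the role of \<open>t\<close>, and variable \<open>i\<close> with \<open>1 \<le> i \<le> n\<close> is \<open>x\<^sub>i\<close>.
  A monomial is its exponent vector.\<close>
type_synonym monomial = "nat \<Rightarrow>\<^sub>0 nat"
type_synonym 'a mpoly = "monomial \<Rightarrow>\<^sub>0 'a"

definition Const :: "'a \<Rightarrow> 'a::comm_ring_1 mpoly" where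
  "Const c = Poly_Mapping.single 0 c"

definition Var :: "nat \<Rightarrow> 'a::comm_ring_1 mpoly" where
  "Var i = Poly_Mapping.single (Poly_Mapping.single i 1) 1"

definition P_ring :: "nat \<Rightarrow> 'a::comm_ring_1 mpoly set" where
  "P_ring n = {p. \<forall>a\<in>Poly_Mapping.keys p. Poly_Mapping.keys a \<subseteq> {1..n}}"

definition weighted_degree :: "nat \<Rightarrow> (nat \<Rightarrow> nat) \<Rightarrow> monomial \<Rightarrow> nat" where
  "weighted_degree n w a = (\<Sum>i=1..n. w i * Poly_Mapping.lookup a i)"

definition P_comp :: "nat \<Rightarrow> (nat \<Rightarrow> nat) \<Rightarrow> nat \<Rightarrow> 'a::comm_ring_1 mpoly set" where
  "P_comp n w m = {p \<in> P_ring n. \<forall>a\<in>Poly_Mapping.keys p. weighted_degree n w a = m}"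

definition R_ring :: "nat \<Rightarrow> (nat \<Rightarrow> nat) \<Rightarrow> 'a::comm_ring_1 mpoly set" where
  "R_ring n w = is_subring hull
     (range Const \<union> {Var 0 ^ d * Var i | i d. i \<in> {1..n} \<and> d \<in> {0..w i}})"

definition R_comp :: "nat \<Rightarrow> (nat \<Rightarrow> nat) \<Rightarrow> nat \<Rightarrow> 'a::comm_ring_1 mpoly set" where
  "R_comp n w m = {p \<in> R_ring n w. \<forall>a\<in>Poly_Mapping.keys p. Poly_Mapping.lookup a 0 = m}"

end

theory Submission
  imports Defs "HOL-Library.Multiset"
begin

text \<open>
  Both rings are spanned by monomials, so it suffices to split an exponent vector, seen as a
  multiset \<open>A\<close> of indices of total weight at least \<open>2d\<close>, into a part of weight exactly \<open>d\<close> and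
  a rest. Since the weight of \<open>A\<close> exceeds \<open>(M - 2) \<Sum> w\<^sub>i\<close> with \<open>M = max w\<close>, some
  index \<open>i\<close> occurs at least \<open>M - 1\<close> times; put \<open>u = w\<^sub>i\<close>. Among the other indices choose
  \<open>B\<close> of maximal weight subject to this weight being at most \<open>d\<close> and divisible by \<open>u\<close>. If copies of
  \<open>i\<close> cannot fill the gap up to \<open>d\<close>, the gap is at least \<open>u M\<close>, so by maximality the leftover has
  no nonempty subset of size at most \<open>u\<close> with weight divisible by \<open>u\<close>. By the pigeonhole principle the
  leftover has fewer than \<open>u\<close> elements, none of weight \<open>u\<close>, and the hypothesis on \<open>d\<close> bounds
  its weight by \<open>d\<close>, which makes the total weight smaller than \<open>2d\<close>.
\<close>

section \<open>Subsums of prescribed weight\<close>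

text \<open>Pigeonhole on prefix sums: list \<open>A\<close> and reduce the \<open>u + 1\<close>
  sums of the first 0, ..., \<open>u\<close> values modulo \<open>u\<close>. Two of them agree, and
  the block between the two positions has sum divisible by \<open>u\<close>.\<close>

lemma zero_sum_submultiset:
  fixes f :: "'b \<Rightarrow> nat"
  assumes "0 < u" "u \<le> size A"
  shows "\<exists>B. B \<subseteq># A \<and> B \<noteq> {#} \<and> size B \<le> u \<and> u dvd (\<Sum>i\<in>#B. f i)"
proof -
  obtain xs where xs: "mset xs = A" by (rule ex_mset[THEN exE])
  then have len: "u \<le> length xs" using assms by auto
  define s where "s k = sum_list (map f (take k xs)) mod u" for k
  have "s ` {..u} \<subseteq> {..<u}" using assms(1) by (auto simp: s_def)
  then have "card (s ` {..u}) \<le> u" using card_mono[of "{..<u}"] by fastforce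
  then have "\<not> inj_on s {..u}" using card_image[of s "{..u}"] by auto
  then obtain j k where jk: "j < k" "k \<le> u" "s j = s k"
    unfolding inj_on_def by (metis atMost_iff linorder_neqE_nat)
  define ys where "ys = drop j (take k xs)"
  have tk: "take k xs = take j xs @ ys"
    using jk(1) by (metis append_take_drop_id less_imp_le min.absorb1 take_take ys_def)
  have "(sum_list (map f (take j xs)) + sum_list (map f ys)) mod u = sum_list (map f (take j xs)) mod u"
    using jk(3) by (simp add: s_def tk)
  then have "u dvd sum_list (map f ys)"
    by (metis add_diff_cancel_left' le_add1 mod_eq_dvd_iff_nat)
  moreover have "mset ys \<subseteq># A"
    unfolding xs[symmetric] ys_def
    by (metis append_take_drop_id mset_append mset_subset_eq_add_left mset_subset_eq_add_right subset_mset.order_trans)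
  moreover have "length ys = k - j" using len jk by (simp add: ys_def)
  ultimately show ?thesis
    using jk by (intro exI[of _ "mset ys"]) (auto simp flip: sum_mset_sum_list mset_map)
qed

text \<open>If \<open>u\<close> and \<open>v\<close> differ by at least 2, expanding shows
  \<open>2 * (u - 1) * v \<le> (max u v - 2) * (u + v)\<close>, which is less than
  \<open>2 * d\<close>. This comparison can fail for consecutive numbers, but those are coprime, so
  that \<open>u * v\<close> divides \<open>d\<close>.\<close>

lemma pred_times_le:
  fixes u v d :: nat
  assumes "u \<noteq> v" "0 < u" "0 < v" "u dvd d" "v dvd d" "0 < d"
    and "2 * int d > (int (max u v) - 2) * (int u + int v)"
  shows "(u - 1) * v \<le> d"
proof (cases "u = v + 1 \<or> v = u + 1")
  case True
  then have "coprime u v" by auto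
  then have "u * v dvd d" using assms by (simp add: divides_mult)
  then have "u * v \<le> d" using assms by (simp add: dvd_imp_le)
  then show ?thesis by (meson diff_le_self le_trans mult_le_mono1)
next
  case False
  have "2 * ((int u - 1) * int v) \<le> (int (max u v) - 2) * (int u + int v)"
  proof (cases "u < v")
    case True
    then have "int v - int u \<ge> 2" using False by linarith
    then have "int v * 2 \<le> int v * (int v - int u)" by (intro mult_left_mono) auto
    with True show ?thesis by (simp add: algebra_simps max_def)
  next
    case nl: False
    then have "int u - 2 - int v \<ge> 0" using False assms by linarith
    then have "0 \<le> int u * (int u - 2 - int v)" by (intro mult_nonneg_nonneg) auto
    with nl show ?thesis by (simp add: algebra_simps max_def)
  qed
  then have "(int u - 1) * int v \<le> int d" using assms by linarith
  moreover have "int ((u - 1) * v) = (int u - 1) * int v" using assms by (simp add: of_nat_diff)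
  ultimately show ?thesis by linarith
qed

lemma weight_eq_sum_count:
  fixes w :: "'b \<Rightarrow> nat"
  assumes "finite I" "set_mset A \<subseteq> I"
  shows "(\<Sum>i\<in>#A. w i) = (\<Sum>i\<in>I. count A i * w i)"
  using assms(2)
proof (induction A)
  case (add x A)
  then have "(\<Sum>i\<in>I. count (add_mset x A) i * w i) = (\<Sum>i\<in>I. (if i = x then w i else 0) + count A i * w i)"
    by (intro sum.cong) auto
  with add assms(1) show ?case by (simp add: sum.distrib)
qed simp

lemma weight_le:
  fixes w :: "'b \<Rightarrow> nat"
  assumes "\<And>j. j \<in># A \<Longrightarrow> c * w j \<le> b"
  shows "c * (\<Sum>j\<in>#A. w j) \<le> size A * b"
  using assms
proof (induction A)
  case (add x A)
  then have "c * w x \<le> b" "c * (\<Sum>j\<in>#A. w j) \<le> size A * b" by auto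
  then show ?case by (simp add: algebra_simps)
qed simp

text \<open>The combinatorial core. With \<open>d\<close> the lcm and \<open>M\<close> the maximum
  of the weights, it cuts a factor of degree exactly \<open>d\<close> off a monomial of degree at
  least \<open>2 * d\<close>.\<close>

lemma exists_submultiset_weight_eq:
  fixes A :: "'b multiset" and w :: "'b \<Rightarrow> nat"
  assumes fin: "finite I" and A: "set_mset A \<subseteq> I"
    and w: "\<And>i. i \<in> I \<Longrightarrow> 0 < w i \<and> w i dvd d \<and> w i \<le> M"
    and d: "0 < d" "2 * int d > (int M - 2) * int (\<Sum>i\<in>I. w i)"
    and wA: "2 * d \<le> (\<Sum>i\<in>#A. w i)"
  shows "\<exists>B. B \<subseteq># A \<and> (\<Sum>i\<in>#B. w i) = d"
proof -
  let ?W = "\<lambda>B. \<Sum>i\<in>#B. w i"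
  \<comment> \<open>Otherwise every multiplicity is at most \<open>M - 2\<close> and the weight of
    \<open>A\<close> is below \<open>2 * d\<close>. The estimate is made over the integers, where
    \<open>M - 2\<close> may be negative.\<close>
  have "\<exists>i\<in>I. M \<le> count A i + 1"
  proof (rule ccontr)
    assume "\<not> ?thesis"
    then have "int (count A i) * int (w i) \<le> (int M - 2) * int (w i)" if "i \<in> I" for i
      using that by (intro mult_right_mono) force+
    then have "(\<Sum>i\<in>I. int (count A i) * int (w i)) \<le> (\<Sum>i\<in>I. (int M - 2) * int (w i))"
      by (rule sum_mono)
    also have "\<dots> = (int M - 2) * int (\<Sum>i\<in>I. w i)"
      by (simp add: sum_distrib_left)
    finally have "int (?W A) < 2 * int d"
      using weight_eq_sum_count[OF fin A, of w] d(2) by simp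
    then show False using wA by linarith
  qed
  then obtain i where i: "i \<in> I" "M \<le> count A i + 1" by blast
  define u k where "u = w i" and "k = count A i"
  have u: "0 < u" "u dvd d" "u \<le> M" using w[OF i(1)] by (auto simp: u_def)
  define C where "C = {#j \<in># A. j \<noteq> i#}"
  have AC: "A = replicate_mset k i + C"
    by (rule multiset_eqI) (auto simp: C_def k_def)
  have CI: "j \<in> I" "j \<noteq> i" if "j \<in># C" for j using that A by (auto simp: C_def)
  \<comment> \<open>\<open>B\<close> avoids \<open>i\<close>, and divisibility by \<open>u\<close>
    makes the gap up to \<open>d\<close> a multiple of \<open>u\<close>, so that only copies of
    \<open>i\<close> are needed to close it.\<close>
  define P where "P B \<longleftrightarrow> B \<subseteq># C \<and> u dvd ?W B \<and> ?W B \<le> d" for B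
  have "P {#}" by (simp add: P_def)
  moreover have "\<forall>B. P B \<longrightarrow> ?W B < Suc d" by (simp add: P_def)
  ultimately have "\<exists>B. P B \<and> (\<forall>E. P E \<longrightarrow> ?W E \<le> ?W B)"
    by (rule ex_has_greatest_nat)
  then obtain B where "P B" and max: "\<And>E. P E \<Longrightarrow> ?W E \<le> ?W B" by blast
  then have B: "B \<subseteq># C" "u dvd ?W B" "?W B \<le> d" by (auto simp: P_def)
  have "d \<le> ?W B + u * k"
  proof (rule ccontr)
    assume neg: "\<not> ?thesis"
    have "u dvd d - ?W B" using B u by (intro dvd_diff_nat) auto
    then obtain q where q: "d - ?W B = u * q" by blast
    \<comment> \<open>The gap consists of \<open>q > k\<close> copies of \<open>u\<close>, and
      \<open>k \<ge> M - 1\<close> by the choice of \<open>i\<close>.\<close>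
    with neg have "u * k < u * q" by linarith
    then have "M \<le> q" using i(2) by (simp add: k_def)
    then have room: "?W B + u * M \<le> d" using q B
      by (metis add_le_cancel_left le_add_diff_inverse mult_le_mono2)
    define D where "D = C - B"
    have CBD: "C = B + D" using B by (simp add: D_def)
    \<comment> \<open>At most \<open>u\<close> indices weigh at most \<open>u * M\<close>, which
      still fits into the gap. Adding such an \<open>E\<close> to \<open>B\<close> would contradict
      maximality, since all weights are positive.\<close>
    have no: "E = {#}" if E: "E \<subseteq># D" "size E \<le> u" "u dvd ?W E" for E
    proof (rule ccontr)
      assume "E \<noteq> {#}"
      then obtain j where j: "j \<in># E" by blast
      have inI: "x \<in> I" if "x \<in># E" for x
        using that E(1) CI(1) by (metis CBD mset_subset_eqD mset_subset_eq_add_right)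
      have "1 * ?W E \<le> size E * M" using w[OF inI] by (intro weight_le) auto
      also have "\<dots> \<le> u * M" using E by simp
      finally have "P (B + E)" using room B E by (auto simp: CBD P_def)
      then have "?W (B + E) \<le> ?W B" by (rule max)
      then have "?W E = 0" by simp
      then show False using j w[OF inI[OF j]] by auto
    qed
    have sD: "size D < u"
      using zero_sum_submultiset[of u D w] no u(1) by (meson not_le)
    have "(u - 1) * w j \<le> d" if j: "j \<in># D" for j
    proof (rule pred_times_le)
      have jI: "j \<in> I" "j \<noteq> i" using CI[of j] j by (auto simp: CBD)
      show wj: "0 < w j" "w j dvd d" using w[OF jI(1)] by auto
      show ne: "u \<noteq> w j" using no[of "{#j#}"] j u(1) by auto
      show "0 < u" "u dvd d" "0 < d" using u d by auto
      \<comment> \<open>Distinct positive weights have maximum at least 2, hence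
        \<open>M - 2\<close> is nonnegative and the bound on \<open>d\<close> for all of
        \<open>I\<close> passes to the pair \<open>{i, j}\<close>.\<close>
      have mx: "max u (w j) \<le> M" "1 < max u (w j)" using u w[OF jI(1)] ne by auto
      have "u + w j = (\<Sum>x\<in>{i, j}. w x)" using jI by (simp add: u_def)
      also have "\<dots> \<le> (\<Sum>x\<in>I. w x)" using fin jI i by (intro sum_mono2) auto
      finally have "int u + int (w j) \<le> int (\<Sum>x\<in>I. w x)" by linarith
      then have "(int (max u (w j)) - 2) * (int u + int (w j)) \<le> (int M - 2) * int (\<Sum>x\<in>I. w x)"
        using mx by (intro mult_mono) linarith+
      with d show "2 * int d > (int (max u (w j)) - 2) * (int u + int (w j))" by linarith
    qed
    then have "(u - 1) * ?W D \<le> size D * d" by (rule weight_le)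
    also have "\<dots> \<le> (u - 1) * d" using sD by (intro mult_le_mono1) linarith
    \<comment> \<open>Cancelling \<open>u - 1\<close> requires \<open>u > 1\<close>; for
      \<open>u = 1\<close> the leftover \<open>D\<close> is empty.\<close>
    finally have "?W D \<le> d" using sD by (cases "u = 1") auto
    moreover have "?W A = u * k + (?W B + ?W D)"
      by (simp add: AC CBD u_def)
    ultimately show False using neg wA by linarith
  qed
  \<comment> \<open>The gap is now known to need \<open>q \<le> k\<close> copies of
    \<open>i\<close>, and these complete \<open>B\<close> to weight \<open>d\<close>.\<close>
  moreover obtain q where q: "d - ?W B = u * q"
    using B u by (metis dvd_diff_nat dvdE)
  ultimately have "u * q \<le> u * k" by linarith
  then have "q \<le> k" using u by simp
  then have "B + replicate_mset q i \<subseteq># A"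
    unfolding AC using B by (metis add.commute mset_subset_eq_mono_add replicate_mset_msubseteq_iff)
  moreover have "?W B + u * q = d" using q B by linarith
  then have "?W (B + replicate_mset q i) = d" by (simp add: u_def mult.commute)
  ultimately show ?thesis by blast
qed

section \<open>Gradings by monomials\<close>

text \<open>Both rings and all their graded components have this form, so statements about them
  become statements about sets of exponent vectors.\<close>

definition monomial_span :: "'k set \<Rightarrow> ('k \<Rightarrow>\<^sub>0 'a::zero) set" where
  "monomial_span K = {p. Poly_Mapping.keys p \<subseteq> K}"

lemma monomial_span_iff:
  "p \<in> monomial_span K \<longleftrightarrow> (\<forall>a. a \<notin> K \<longrightarrow> Poly_Mapping.lookup p a = 0)"
  by (auto simp: monomial_span_def in_keys_iff)

lemma poly_mapping_eq_sum_single: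
  fixes p :: "'k \<Rightarrow>\<^sub>0 'a::comm_monoid_add"
  shows "p = (\<Sum>a\<in>Poly_Mapping.keys p. Poly_Mapping.single a (Poly_Mapping.lookup p a))"
  by (rule poly_mapping_eqI)
    (auto simp: lookup_sum lookup_single when_def sum.delta' in_keys_iff)

lemma additive_subgroup_sum:
  assumes "is_additive_subgroup A" "\<And>i. i \<in> I \<Longrightarrow> f i \<in> A"
  shows "sum f I \<in> A"
proof -
  have diff: "a - b \<in> A" if "a \<in> A" "b \<in> A" for a b
    using assms(1) that by (auto simp: is_additive_subgroup_def)
  have "0 \<in> A" using assms(1) by (simp add: is_additive_subgroup_def)
  then have "a + b \<in> A" if "a \<in> A" "b \<in> A" for a b
    using diff[OF that(1) diff[OF \<open>0 \<in> A\<close> that(2)]] by simp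
  with \<open>0 \<in> A\<close> assms(2) show ?thesis by (induction I rule: infinite_finite_induct) auto
qed

lemma is_additive_subgroup_monomial_span:
  "is_additive_subgroup (monomial_span K :: ('k \<Rightarrow>\<^sub>0 'a::ab_group_add) set)"
  by (auto simp: is_additive_subgroup_def monomial_span_iff lookup_minus)

lemma monomial_span_mult:
  fixes p q :: "'k::comm_monoid_add \<Rightarrow>\<^sub>0 'a::comm_ring_1"
  assumes "p \<in> monomial_span K" "q \<in> monomial_span L"
    and "\<And>a b. a \<in> K \<Longrightarrow> b \<in> L \<Longrightarrow> a + b \<in> M"
  shows "p * q \<in> monomial_span M"
  using assms keys_mult[of p q] by (fastforce simp: monomial_span_def)

lemma is_subring_monomial_span:
  fixes K :: "'k::comm_monoid_add set"
  assumes "0 \<in> K" "\<And>a b. a \<in> K \<Longrightarrow> b \<in> K \<Longrightarrow> a + b \<in> K"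
  shows "is_subring (monomial_span K :: ('k \<Rightarrow>\<^sub>0 'a::comm_ring_1) set)"
  unfolding is_subring_def
proof (intro conjI ballI)
  show "1 \<in> (monomial_span K :: ('k \<Rightarrow>\<^sub>0 'a) set)"
    using assms(1) by (simp add: monomial_span_def)
  fix p q :: "'k \<Rightarrow>\<^sub>0 'a" assume pq: "p \<in> monomial_span K" "q \<in> monomial_span K"
  then show "p - q \<in> monomial_span K" by (simp add: monomial_span_iff lookup_minus)
  show "p * q \<in> monomial_span K" using pq assms(2) by (rule monomial_span_mult)
qed

lemma monomial_span_subset:
  fixes A :: "('k \<Rightarrow>\<^sub>0 'a::ab_group_add) set"
  assumes "is_additive_subgroup A"
    and "\<And>a c. a \<in> K \<Longrightarrow> Poly_Mapping.single a c \<in> A"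
  shows "monomial_span K \<subseteq> A"
proof
  fix p :: "'k \<Rightarrow>\<^sub>0 'a" assume "p \<in> monomial_span K"
  then show "p \<in> A"
    by (subst poly_mapping_eq_sum_single)
      (auto intro!: additive_subgroup_sum assms simp: monomial_span_def)
qed

section \<open>Direct sums of monomial spans\<close>

lemma lookup_total_sum:
  fixes K :: "nat \<Rightarrow> 'k set"
  assumes f: "f \<in> finitely_supported (\<lambda>m. monomial_span (K m))"
    and disj: "\<And>i j. i \<noteq> j \<Longrightarrow> K i \<inter> K j = {}" and a: "a \<in> K m"
  shows "Poly_Mapping.lookup (total_sum f) a = Poly_Mapping.lookup (f m) a"
proof -
  have fin: "finite {m. f m \<noteq> 0}" using f by (simp add: finitely_supported_def)
  have "Poly_Mapping.lookup (f j) a = 0" if "j \<noteq> m" for j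
    using f a disj[OF that] by (auto simp: finitely_supported_def monomial_span_iff)
  then have "Poly_Mapping.lookup (total_sum f) a =
      (\<Sum>j | f j \<noteq> 0. if j = m then Poly_Mapping.lookup (f m) a else 0)"
    unfolding total_sum_def lookup_sum by (intro sum.cong) auto
  also have "\<dots> = Poly_Mapping.lookup (f m) a"
    using fin by (simp add: sum.delta)
  finally show ?thesis .
qed

text \<open>Disjointness lets every coefficient of a sum come from a single summand, which gives
  injectivity. For surjectivity, a polynomial is the sum of its restrictions to the sets
  \<open>K m\<close>.\<close>

lemma internal_direct_sum_monomial_span:
  fixes K :: "nat \<Rightarrow> 'k set"
  assumes disj: "\<And>i j. i \<noteq> j \<Longrightarrow> K i \<inter> K j = {}"
  shows "internal_direct_sum (monomial_span (\<Union>m. K m) :: ('k \<Rightarrow>\<^sub>0 'a::ab_group_add) set)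
    (\<lambda>m. monomial_span (K m))"
proof -
  let ?F = "finitely_supported (\<lambda>m. monomial_span (K m) :: ('k \<Rightarrow>\<^sub>0 'a) set)"
  have "inj_on total_sum ?F"
  proof (rule inj_onI, rule ext, rule poly_mapping_eqI)
    fix f g m a
    assume fg: "f \<in> ?F" "g \<in> ?F" "total_sum f = total_sum g"
    show "Poly_Mapping.lookup (f m) a = Poly_Mapping.lookup (g m) a"
    proof (cases "a \<in> K m")
      case True
      then show ?thesis
        using lookup_total_sum[OF fg(1) disj True] lookup_total_sum[OF fg(2) disj True] fg(3) by simp
    next
      case False
      then show ?thesis using fg by (auto simp: finitely_supported_def monomial_span_iff)
    qed
  qed
  moreover have in_span: "total_sum f \<in> monomial_span (\<Union>m. K m)" if "f \<in> ?F" for f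
    unfolding total_sum_def
    by (rule additive_subgroup_sum[OF is_additive_subgroup_monomial_span])
      (use that in \<open>auto simp: finitely_supported_def monomial_span_iff\<close>)
  moreover have "p \<in> total_sum ` ?F" if p: "p \<in> monomial_span (\<Union>m. K m)" for p
  proof -
    define f where "f m = (\<Sum>a\<in>Poly_Mapping.keys p \<inter> K m.
      Poly_Mapping.single a (Poly_Mapping.lookup p a))" for m
    have f: "Poly_Mapping.lookup (f m) a = (if a \<in> K m then Poly_Mapping.lookup p a else 0)" for m a
      by (auto simp: f_def lookup_sum lookup_single when_def sum.delta' in_keys_iff)
    \<comment> \<open>A nonzero restriction contains a key of \<open>p\<close>, and by disjointness
      this key determines \<open>m\<close>; so only finitely many restrictions are nonzero.\<close>
    have "{m. f m \<noteq> 0} \<subseteq> (\<lambda>a. THE m. a \<in> K m) ` Poly_Mapping.keys p"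
    proof
      fix m assume "m \<in> {m. f m \<noteq> 0}"
      then obtain a where "Poly_Mapping.lookup (f m) a \<noteq> 0"
        by (metis (mono_tags) lookup_zero mem_Collect_eq poly_mapping_eqI)
      then have a: "a \<in> Poly_Mapping.keys p" "a \<in> K m"
        by (auto simp: f in_keys_iff split: if_splits)
      then have "(THE m. a \<in> K m) = m" using disj by (intro the_equality) auto
      with a show "m \<in> (\<lambda>a. THE m. a \<in> K m) ` Poly_Mapping.keys p" by force
    qed
    then have "finite {m. f m \<noteq> 0}" by (rule finite_subset) simp
    then have fF: "f \<in> ?F" by (simp add: finitely_supported_def monomial_span_iff f)
    then have "total_sum f \<in> monomial_span (\<Union>m. K m)" by (rule in_span)
    have "total_sum f = p"
    proof (rule poly_mapping_eqI)
      fix a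
      show "Poly_Mapping.lookup (total_sum f) a = Poly_Mapping.lookup p a"
      proof (cases "a \<in> (\<Union>m. K m)")
        case True
        then obtain m where m: "a \<in> K m" by blast
        then show ?thesis using lookup_total_sum[OF fF disj m] f by simp
      next
        case False
        then show ?thesis
          using p in_span[OF fF] unfolding monomial_span_iff by metis
      qed
    qed
    then show ?thesis using fF by blast
  qed
  ultimately show ?thesis
    unfolding internal_direct_sum_def bij_betw_def
    by (blast intro: is_additive_subgroup_monomial_span)
qed

section \<open>Powers of the degree-one component\<close>

lemma is_additive_subgroup_group_closure: "is_additive_subgroup (group_closure S)"
  by (simp add: is_additive_subgroup_def group_closure.diff)

lemma group_closure_subset:
  assumes "is_additive_subgroup A" "S \<subseteq> A"
  shows "group_closure S \<subseteq> A"
proof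
  fix x assume "x \<in> group_closure S"
  then show "x \<in> A"
    by induction (use assms in \<open>auto simp: is_additive_subgroup_def\<close>)
qed

lemma prod_in_monomial_span:
  fixes K :: "nat \<Rightarrow> 'k::comm_monoid_add set" and f :: "nat \<Rightarrow> 'k \<Rightarrow>\<^sub>0 'a::comm_ring_1"
  assumes "0 \<in> K 0" "\<And>i j a b. a \<in> K i \<Longrightarrow> b \<in> K j \<Longrightarrow> a + b \<in> K (i + j)"
    and "\<And>i. i < m \<Longrightarrow> f i \<in> monomial_span (K 1)"
  shows "(\<Prod>i<m. f i) \<in> monomial_span (K m)"
  using assms(3)
proof (induction m)
  case 0
  then show ?case using assms(1) by (simp add: monomial_span_def)
next
  case (Suc m)
  then have "(\<Prod>i<m. f i) \<in> monomial_span (K m)" "f m \<in> monomial_span (K 1)" by auto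
  then have "(\<Prod>i<m. f i) * f m \<in> monomial_span (K (m + 1))"
    using assms(2) by (rule monomial_span_mult)
  then show ?case by simp
qed

text \<open>Peel off one exponent vector of \<open>K 1\<close> at a time. Each factor peeled off
  gets coefficient 1, and the last remaining one carries \<open>c\<close>.\<close>

lemma single_in_products:
  fixes K :: "nat \<Rightarrow> 'k::comm_monoid_add set" and c :: "'a::comm_ring_1"
  assumes split: "\<And>m a. 1 \<le> m \<Longrightarrow> a \<in> K (Suc m) \<Longrightarrow> \<exists>b\<in>K 1. \<exists>c\<in>K m. a = b + c"
    and "1 \<le> m" "a \<in> K m"
  shows "\<exists>f. (\<forall>i<m. f i \<in> monomial_span (K 1)) \<and> Poly_Mapping.single a c = (\<Prod>i<m. f i)"
  using assms(2,3)
proof (induction m arbitrary: a rule: nat_induct_at_least)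
  case base
  then show ?case
    by (intro exI[of _ "\<lambda>_. Poly_Mapping.single a c"]) (auto simp: monomial_span_def)
next
  case (Suc m)
  then obtain b b' where b: "b \<in> K 1" "b' \<in> K m" "a = b + b'" using split by blast
  then obtain f where f: "\<forall>i<m. f i \<in> monomial_span (K 1)"
      "Poly_Mapping.single b' c = (\<Prod>i<m. f i)" using Suc.IH by blast
  let ?f = "f(m := Poly_Mapping.single b 1)"
  have "(\<Prod>i<m. ?f i) = Poly_Mapping.single b' c"
    unfolding f(2) by (intro prod.cong) auto
  then have "(\<Prod>i<Suc m. ?f i) = Poly_Mapping.single b' c * Poly_Mapping.single b 1"
    by (simp only: prod.lessThan_Suc fun_upd_same)
  then have "Poly_Mapping.single a c = (\<Prod>i<Suc m. ?f i)"
    by (simp only: mult_single b(3) add.commute mult_1_right)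
  moreover have "\<forall>i<Suc m. ?f i \<in> monomial_span (K 1)"
    using f b by (auto simp: less_Suc_eq monomial_span_def)
  ultimately show ?case by blast
qed

text \<open>Products add exponents; conversely each single term is an \<open>m\<close>-fold product,
  and every polynomial is a sum of terms. For \<open>m = 0\<close> the only product is 1, whose
  additive closure may be smaller than the degree-zero component.\<close>

lemma set_pow_monomial_span:
  fixes K :: "nat \<Rightarrow> 'k::comm_monoid_add set"
  assumes "0 \<in> K 0" "\<And>i j a b. a \<in> K i \<Longrightarrow> b \<in> K j \<Longrightarrow> a + b \<in> K (i + j)"
    and "\<And>m a. 1 \<le> m \<Longrightarrow> a \<in> K (Suc m) \<Longrightarrow> \<exists>b\<in>K 1. \<exists>c\<in>K m. a = b + c"
    and "1 \<le> m"
  shows "set_pow (monomial_span (K 1) :: ('k \<Rightarrow>\<^sub>0 'a::comm_ring_1) set) m = monomial_span (K m)"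
proof
  show "set_pow (monomial_span (K 1) :: ('k \<Rightarrow>\<^sub>0 'a) set) m \<subseteq> monomial_span (K m)"
    unfolding set_pow_def
    by (rule group_closure_subset[OF is_additive_subgroup_monomial_span])
      (auto intro!: prod_in_monomial_span assms(1,2))
  have "Poly_Mapping.single a c \<in> set_pow (monomial_span (K 1)) m" if "a \<in> K m" for a and c :: 'a
    using single_in_products[OF assms(3,4) that, of c]
    unfolding set_pow_def by (intro group_closure.base) blast
  then show "monomial_span (K m) \<subseteq> set_pow (monomial_span (K 1) :: ('k \<Rightarrow>\<^sub>0 'a) set) m"
    by (intro monomial_span_subset) (simp_all add: set_pow_def is_additive_subgroup_group_closure)
qed

text \<open>Reduces generation in degree 1 to the splitting of exponent vectors of degree
  \<open>d + d * m\<close> into degrees \<open>d\<close> and \<open>d * m\<close>.\<close>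

lemma generated_in_degree_1_veronese:
  fixes K :: "nat \<Rightarrow> 'k::comm_monoid_add set"
    and G :: "nat \<Rightarrow> ('k \<Rightarrow>\<^sub>0 'a::comm_ring_1) set"
  assumes G: "\<And>m. G m = monomial_span (K m)" and d: "0 < d"
    and disj: "\<And>i j. i \<noteq> j \<Longrightarrow> K i \<inter> K j = {}"
    and zero: "0 \<in> K 0" and add: "\<And>i j a b. a \<in> K i \<Longrightarrow> b \<in> K j \<Longrightarrow> a + b \<in> K (i + j)"
    and split: "\<And>m a. 1 \<le> m \<Longrightarrow> a \<in> K (d + d * m) \<Longrightarrow> \<exists>b\<in>K d. \<exists>c\<in>K (d * m). a = b + c"
  shows "generated_in_degree_1 (veronese_ring d G) (veronese_comp d G)"
proof -
  define L where "L m = K (d * m)" for m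
  have VG: "veronese_comp d G = (\<lambda>m. monomial_span (L m))"
    by (auto simp: veronese_comp_def G L_def)
  have L_disj: "L i \<inter> L j = {}" if "i \<noteq> j" for i j using disj that d by (simp add: L_def)
  have L0: "0 \<in> L 0" using zero by (simp add: L_def)
  have L_add: "a + b \<in> L (i + j)" if "a \<in> L i" "b \<in> L j" for i j a b
    using that add by (simp add: L_def distrib_left)
  have L_split: "\<exists>b\<in>L 1. \<exists>c\<in>L m. a = b + c" if "1 \<le> m" "a \<in> L (Suc m)" for m a
    using that split by (simp add: L_def)
  have ids: "internal_direct_sum (monomial_span (\<Union>m. L m) :: ('k \<Rightarrow>\<^sub>0 'a) set)
      (\<lambda>m. monomial_span (L m))"
    using L_disj by (rule internal_direct_sum_monomial_span)
  have VR: "veronese_ring d G = monomial_span (\<Union>m. L m)"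
    using ids by (simp add: veronese_ring_def VG internal_direct_sum_def bij_betw_def)
  have "is_subring (monomial_span (\<Union>m. L m) :: ('k \<Rightarrow>\<^sub>0 'a) set)"
    by (rule is_subring_monomial_span) (use L0 L_add in blast)+
  moreover have "p * q \<in> monomial_span (L (i + j))"
    if "p \<in> monomial_span (L i)" "q \<in> monomial_span (L j)" for p q :: "'k \<Rightarrow>\<^sub>0 'a" and i j
    using that L_add by (rule monomial_span_mult)
  moreover have "set_pow (monomial_span (L 1) :: ('k \<Rightarrow>\<^sub>0 'a) set) m = monomial_span (L m)"
    if "1 \<le> m" for m
    using L0 L_add L_split that by (rule set_pow_monomial_span)
  \<comment> \<open>The family of powers equals the family of components, so one direct sum
    decomposition serves both the grading and the generation property.\<close>
  then have "(\<lambda>m. if m = 0 then monomial_span (L 0) else set_pow (monomial_span (L 1)) m)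
      = (\<lambda>m. monomial_span (L m) :: ('k \<Rightarrow>\<^sub>0 'a) set)"
    by (intro ext) auto
  ultimately show ?thesis
    using ids unfolding generated_in_degree_1_def graded_ring_def VG VR by auto
qed

section \<open>The weighted polynomial ring and the Rees ring\<close>

text \<open>Exponent vectors are the multiplicity functions of multisets of indices; the multiset
  form allows induction on single variables and the use of submultisets.\<close>

definition monom_of :: "nat multiset \<Rightarrow> monomial" where
  "monom_of A = (\<Sum>i\<in>#A. Poly_Mapping.single i 1)"

lemma monom_of_simps [simp]:
  "monom_of {#} = 0" "monom_of (add_mset i A) = Poly_Mapping.single i 1 + monom_of A"
  "monom_of (A + B) = monom_of A + monom_of B"
  by (simp_all add: monom_of_def)

lemma lookup_monom_of [simp]: "Poly_Mapping.lookup (monom_of A) i = count A i"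
  by (induction A) (auto simp: lookup_add lookup_single when_def)

lemma keys_monom_of [simp]: "Poly_Mapping.keys (monom_of A) = set_mset A"
  by (auto simp: in_keys_iff)

lemma monom_of_exhaust: obtains A where "a = monom_of A"
proof
  show "a = monom_of (Abs_multiset (Poly_Mapping.lookup a))"
    by (rule poly_mapping_eqI)
      (simp add: Abs_multiset_inverse)
qed

lemma weighted_degree_monom_of:
  "set_mset A \<subseteq> {1..n} \<Longrightarrow> weighted_degree n w (monom_of A) = (\<Sum>i\<in>#A. w i)"
  by (simp add: weighted_degree_def weight_eq_sum_count[of "{1..n}"] mult.commute)

lemma weighted_degree_add:
  "weighted_degree n w (a + b) = weighted_degree n w a + weighted_degree n w b"
  by (simp add: weighted_degree_def lookup_add distrib_left sum.distrib)

lemma weighted_degree_zero [simp]: "weighted_degree n w 0 = 0"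
  by (simp add: weighted_degree_def)

section \<open>Monomials of the graded components\<close>

definition P_monomials :: "nat \<Rightarrow> (nat \<Rightarrow> nat) \<Rightarrow> nat \<Rightarrow> monomial set" where
  "P_monomials n w m = {a. Poly_Mapping.keys a \<subseteq> {1..n} \<and> weighted_degree n w a = m}"

text \<open>A product of generators \<open>t^e * x_i\<close> with \<open>e \<le> w i\<close> can
  have any exponent of \<open>t\<close> from 0 up to the weight of its
  \<open>x\<close>-part.\<close>

definition R_monomials :: "nat \<Rightarrow> (nat \<Rightarrow> nat) \<Rightarrow> nat \<Rightarrow> monomial set" where
  "R_monomials n w m =
     {Poly_Mapping.single 0 m + monom_of A | A. set_mset A \<subseteq> {1..n} \<and> m \<le> (\<Sum>i\<in>#A. w i)}"

lemma P_comp_eq: "P_comp n w m = monomial_span (P_monomials n w m)"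
  by (auto simp: P_comp_def P_ring_def P_monomials_def monomial_span_def)

lemma R_monomials_add:
  assumes "a \<in> R_monomials n w i" "b \<in> R_monomials n w j"
  shows "a + b \<in> R_monomials n w (i + j)"
proof -
  obtain A B where
    "a = Poly_Mapping.single 0 i + monom_of A" "set_mset A \<subseteq> {1..n}" "i \<le> (\<Sum>i\<in>#A. w i)"
    "b = Poly_Mapping.single 0 j + monom_of B" "set_mset B \<subseteq> {1..n}" "j \<le> (\<Sum>i\<in>#B. w i)"
    using assms by (auto simp: R_monomials_def)
  then show ?thesis
    unfolding R_monomials_def by (intro CollectI exI[of _ "A + B"]) (auto simp: single_add ac_simps)
qed

text \<open>\<open>A\<close> avoids the index 0, so the exponent of \<open>t\<close> comes from the
  first summand alone; in particular distinct degrees share no monomial.\<close>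

lemma lookup_R_monomials: "a \<in> R_monomials n w m \<Longrightarrow> Poly_Mapping.lookup a 0 = m"
  by (auto simp: R_monomials_def lookup_add lookup_single count_eq_zero_iff)

lemma zero_in_R_monomials: "0 \<in> R_monomials n w 0"
  by (auto simp: R_monomials_def intro: exI[of _ "{#}"])

section \<open>The Rees ring as a span of monomials\<close>

lemma Var_power_times_Var:
  "Var 0 ^ e * Var i = (Poly_Mapping.single (Poly_Mapping.single 0 e + Poly_Mapping.single i 1) 1 :: 'a::comm_ring_1 mpoly)"
proof -
  have "Var 0 ^ e = (Poly_Mapping.single (Poly_Mapping.single 0 e) 1 :: 'a mpoly)"
    by (induction e) (auto simp: Var_def mult_single simp flip: single_add)
  then show ?thesis by (simp add: Var_def mult_single)
qed

text \<open>The span is a subring containing the generators. Conversely, each of its monomials is a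
  product of generators, obtained by distributing the power of \<open>t\<close> over the
  variables.\<close>

lemma R_ring_eq:
  "R_ring n w = (monomial_span (\<Union>m. R_monomials n w m) :: 'a::comm_ring_1 mpoly set)"
proof
  let ?gen = "range Const \<union> {Var 0 ^ e * Var i | i e. i \<in> {1..n} \<and> e \<in> {0..w i}} :: 'a mpoly set"
  have gen: "Poly_Mapping.single 0 e + Poly_Mapping.single i 1 \<in> R_monomials n w e"
    if "i \<in> {1..n}" "e \<le> w i" for i e
    using that unfolding R_monomials_def by (intro CollectI exI[of _ "{#i#}"]) auto
  show "R_ring n w \<subseteq> (monomial_span (\<Union>m. R_monomials n w m) :: 'a mpoly set)"
    unfolding R_ring_def
  proof (rule hull_minimal)
    show "?gen \<subseteq> monomial_span (\<Union>m. R_monomials n w m)"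
    proof (rule Un_least)
      show "range Const \<subseteq> (monomial_span (\<Union>m. R_monomials n w m) :: 'a mpoly set)"
        using zero_in_R_monomials[of n w] by (auto simp: monomial_span_def Const_def split: if_splits)
      show "{Var 0 ^ e * Var i | i e. i \<in> {1..n} \<and> e \<in> {0..w i}}
          \<subseteq> (monomial_span (\<Union>m. R_monomials n w m) :: 'a mpoly set)"
      proof
        fix p :: "'a mpoly" assume "p \<in> {Var 0 ^ e * Var i | i e. i \<in> {1..n} \<and> e \<in> {0..w i}}"
        then obtain i e where "i \<in> {1..n}" "e \<le> w i" "p = Var 0 ^ e * Var i" by auto
        then show "p \<in> monomial_span (\<Union>m. R_monomials n w m)"
          using gen[of i e] by (simp only: Var_power_times_Var monomial_span_def) auto
      qed
    qed
    show "is_subring (monomial_span (\<Union>m. R_monomials n w m) :: 'a mpoly set)"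
      by (rule is_subring_monomial_span) (auto intro: zero_in_R_monomials R_monomials_add)
  qed
  let ?H = "R_ring n w :: 'a mpoly set"
  have "is_subring ?H"
    unfolding R_ring_def by (rule hull_in) (auto simp: is_subring_def)
  then have one: "1 \<in> ?H" and diff: "\<And>p q. p \<in> ?H \<Longrightarrow> q \<in> ?H \<Longrightarrow> p - q \<in> ?H"
    and mult: "\<And>p q. p \<in> ?H \<Longrightarrow> q \<in> ?H \<Longrightarrow> p * q \<in> ?H"
    by (auto simp: is_subring_def)
  have Const_H: "Const c \<in> ?H" for c
    unfolding R_ring_def by (rule hull_inc) blast
  have Var_H: "Var 0 ^ e * Var i \<in> ?H" if "i \<in> {1..n}" "e \<le> w i" for e i
    unfolding R_ring_def by (rule hull_inc) (use that in auto)
  have mon: "Poly_Mapping.single (Poly_Mapping.single 0 m + monom_of A) 1 \<in> ?H"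
    if "set_mset A \<subseteq> {1..n}" "m \<le> (\<Sum>i\<in>#A. w i)" for A m
    using that
  proof (induction A arbitrary: m)
    case empty
    then show ?case using one by simp
  next
    case (add i A)
    \<comment> \<open>Greedy choice: the variable \<open>i\<close> takes as much of the power of
      \<open>t\<close> as it can carry, and the remaining \<open>m - e\<close> is at most the weight
      of \<open>A\<close>.\<close>
    define e where "e = min m (w i)"
    let ?q = "Poly_Mapping.single (Poly_Mapping.single 0 (m - e) + monom_of A) (1::'a)"
    have "Var 0 ^ e * Var i \<in> ?H"
      using add.prems by (intro Var_H) (auto simp: e_def)
    moreover have "?q \<in> ?H"
      using add.prems by (intro add.IH) (auto simp: e_def)
    ultimately have "Var 0 ^ e * Var i * ?q \<in> ?H" by (rule mult)
    moreover have "Poly_Mapping.single 0 m + monom_of (add_mset i A) =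
        (Poly_Mapping.single 0 e + Poly_Mapping.single i 1) + (Poly_Mapping.single 0 (m - e) + monom_of A)"
    proof -
      have "Poly_Mapping.single 0 m = Poly_Mapping.single 0 e + Poly_Mapping.single (0::nat) (m - e)"
        by (simp add: e_def flip: single_add)
      then show ?thesis by (simp only: monom_of_simps ac_simps)
    qed
    ultimately show ?case by (simp only: Var_power_times_Var mult_single mult_1_right)
  qed
  show "monomial_span (\<Union>m. R_monomials n w m) \<subseteq> ?H"
  proof (rule monomial_span_subset)
    show "is_additive_subgroup ?H"
      using one diff diff[OF one one] by (simp add: is_additive_subgroup_def)
    fix a and c :: 'a assume "a \<in> (\<Union>m. R_monomials n w m)"
    then have "Poly_Mapping.single a 1 \<in> ?H" using mon by (auto simp: R_monomials_def)
    with Const_H have "Const c * Poly_Mapping.single a 1 \<in> ?H" by (rule mult)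
    then show "Poly_Mapping.single a c \<in> ?H" by (simp add: Const_def mult_single)
  qed
qed

lemma R_comp_eq: "R_comp n w m = monomial_span (R_monomials n w m)"
proof -
  have "(\<Union>m. R_monomials n w m) \<inter> {a. Poly_Mapping.lookup a 0 = m} = R_monomials n w m"
    using lookup_R_monomials by blast
  then show ?thesis by (auto simp: R_comp_def R_ring_eq monomial_span_def)
qed

theorem theorem1p40:
  fixes n d :: nat and w :: "nat \<Rightarrow> nat"
  assumes "n \<ge> 1"
    and "\<And>i. i \<in> {1..n} \<Longrightarrow> w i \<ge> 1"
    and "d = Lcm (w ` {1..n})"
    and "2 * int d > (int (Max (w ` {1..n})) - 2) * int (\<Sum>i=1..n. w i)"
  shows "generated_in_degree_1 (veronese_ring d (P_comp n w) :: 'a::comm_ring_1 mpoly set)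
           (veronese_comp d (P_comp n w)) \<and>
         generated_in_degree_1 (veronese_ring d (R_comp n w) :: 'a mpoly set)
           (veronese_comp d (R_comp n w))"
proof -
  have "0 \<notin> w ` {1..n}" using assms(2) by force
  then have d: "0 < d" unfolding assms(3) by (simp add: Lcm_0_iff_nat zero_less_iff_neq_zero)
  have w: "0 < w i \<and> w i dvd d \<and> w i \<le> Max (w ` {1..n})" if "i \<in> {1..n}" for i
    using assms(2)[OF that] that by (auto simp: assms(3) intro: dvd_Lcm)
  \<comment> \<open>The inequality in the assumption serves both rings: in \<open>P\<close> the
    weight equals \<open>d + d * m\<close>, in the Rees ring it only bounds the exponent of
    \<open>t\<close>.\<close>
  have split: "\<exists>B C. A = B + C \<and> (\<Sum>i\<in>#B. w i) = d \<and> (\<Sum>i\<in>#A. w i) = d + (\<Sum>i\<in>#C. w i)"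
    if A: "set_mset A \<subseteq> {1..n}" and m: "1 \<le> m" "d + d * m \<le> (\<Sum>i\<in>#A. w i)" for A m
  proof -
    have "d \<le> d * m" using m by simp
    then have "2 * d \<le> (\<Sum>i\<in>#A. w i)" using m by linarith
    then obtain B where "B \<subseteq># A" "(\<Sum>i\<in>#B. w i) = d"
      using exists_submultiset_weight_eq[OF finite_atLeastAtMost A w d assms(4)] by blast
    then show ?thesis
      by (metis image_mset_union subset_mset.add_diff_inverse sum_mset.union)
  qed
  show ?thesis
  proof
    show "generated_in_degree_1 (veronese_ring d (P_comp n w) :: 'a mpoly set)
        (veronese_comp d (P_comp n w))"
    proof (rule generated_in_degree_1_veronese[OF P_comp_eq d])
      fix m a assume m: "1 \<le> m" and a: "a \<in> P_monomials n w (d + d * m)"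
      obtain A where A: "a = monom_of A" by (rule monom_of_exhaust)
      with a have sA: "set_mset A \<subseteq> {1..n}" by (simp add: P_monomials_def)
      with a A have wA: "(\<Sum>i\<in>#A. w i) = d + d * m"
        using weighted_degree_monom_of[OF sA, of w] by (simp add: P_monomials_def)
      then obtain B C where BC: "A = B + C" "(\<Sum>i\<in>#B. w i) = d" "(\<Sum>i\<in>#A. w i) = d + (\<Sum>i\<in>#C. w i)"
        using split[OF sA m] by auto
      then have "set_mset B \<subseteq> {1..n}" "set_mset C \<subseteq> {1..n}" using sA by auto
      then have "monom_of B \<in> P_monomials n w d" "monom_of C \<in> P_monomials n w (d * m)"
          "a = monom_of B + monom_of C"
        using A wA BC by (simp_all only: P_monomials_def keys_monom_of weighted_degree_monom_of
          monom_of_simps mem_Collect_eq simp_thms add_left_cancel)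
      then show "\<exists>b\<in>P_monomials n w d. \<exists>c\<in>P_monomials n w (d * m). a = b + c" by blast
    next
      fix i j a b assume "a \<in> P_monomials n w i" "b \<in> P_monomials n w j"
      then show "a + b \<in> P_monomials n w (i + j)"
        using keys_add[of a b] by (auto simp: P_monomials_def weighted_degree_add)
    qed (auto simp: P_monomials_def)
    show "generated_in_degree_1 (veronese_ring d (R_comp n w) :: 'a mpoly set)
        (veronese_comp d (R_comp n w))"
    proof (rule generated_in_degree_1_veronese[OF R_comp_eq d])
      fix m a assume m: "1 \<le> m" and "a \<in> R_monomials n w (d + d * m)"
      then obtain A where A: "a = Poly_Mapping.single 0 (d + d * m) + monom_of A"
        "set_mset A \<subseteq> {1..n}" "d + d * m \<le> (\<Sum>i\<in>#A. w i)"
        by (auto simp: R_monomials_def)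
      then obtain B C where BC: "A = B + C" "(\<Sum>i\<in>#B. w i) = d" "d * m \<le> (\<Sum>i\<in>#C. w i)"
        using split[OF A(2) m A(3)] by auto
      \<comment> \<open>\<open>B\<close> has weight exactly \<open>d\<close> and can carry
        \<open>t^d\<close>, which leaves \<open>C\<close> enough weight for the remaining power of
        \<open>t\<close>.\<close>
      let ?b = "Poly_Mapping.single 0 d + monom_of B"
      let ?c = "Poly_Mapping.single 0 (d * m) + monom_of C"
      have "?b \<in> R_monomials n w d" "?c \<in> R_monomials n w (d * m)"
        using A BC by (auto simp: R_monomials_def)
      moreover have "a = ?b + ?c" using A BC by (simp add: single_add ac_simps)
      ultimately show "\<exists>b\<in>R_monomials n w d. \<exists>c\<in>R_monomials n w (d * m). a = b + c" by blast
    next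
      fix i j :: nat assume "i \<noteq> j"
      then show "R_monomials n w i \<inter> R_monomials n w j = {}" using lookup_R_monomials by blast
    qed (rule zero_in_R_monomials R_monomials_add; assumption?)+
  qed
qed

end
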